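(* For every real $\lambda>0$ there exists $N(\lambda)$ such that, whenever $n\geq N(\lambda)$ and $z_1,\dots,z_n\in\mathbb{C}$ satisfy $|z_j|\geq 1$ for all $1\le j\le n$, one has \[ \max_{2\leq k\leq n+1}\left|\sum_{j=1}^n z_j^k\right|>e^{-\lambda n}. \] Consequently, \[ \lim_{n\to\infty}\Delta_n^{1/n}=\lim_{n\to\infty}(\Delta_n^* )^{1/n}=1. \] In particular, there is no constant $C>1$ such that for every integer $n\geq 2$ there exist $z_1,\dots,z_n\in\mathbb{C}$ with $z_1=1$, $|z_j|\geq 1$ for all $1\le j\le n$, and \[ \max_{2\leq k\leq n+1}\left|\sum_{j=1}^n z_j^k\right|<C^{-n}. \]
   Context: For $z=(z_1,\dots,z_n)\in\mathbb{C}^n$ put $P_n(z)=\max_{2\leq k\leq n+1}\left|\sum_{j=1}^n z_j^k\right|$. Define \[ \Delta_n=\inf\{P_n(z): z_1,\dots,z_n\in\mathbb{C},\ |z_j|\geq 1 \text{ for all } j\}, \] \[ \Delta_n^*=\inf\{P_n(z): z_1=1,\ z_2,\dots,z_n\in\mathbb{C},\ |z_j|\geq 1 \text{ for all } j\}. \] *)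

theory Defs
  imports "HOL-Analysis.Analysis"
begin

text \<open>
  A vector \<open>(z\<^sub>1, \<dots>, z\<^sub>n)\<close> in complex n-space is represented by a function
  \<open>z :: nat \<Rightarrow> complex\<close> of which only the values at the indices \<open>1, \<dots>, n\<close> are used.
  All three functions are meaningful for \<open>n \<ge> 1\<close> only: for \<open>n = 0\<close> the maximum
  is taken over the empty set.
\<close>

definition P :: "nat \<Rightarrow> (nat \<Rightarrow> complex) \<Rightarrow> real" where
  "P n z = Max ((\<lambda>k. cmod (\<Sum>j=1..n. z j ^ k)) ` {2..n+1})"

definition Delta :: "nat \<Rightarrow> real" where
  "Delta n = Inf {P n z | z. \<forall>j\<in>{1..n}. 1 \<le> cmod (z j)}"

definition Delta_star :: "nat \<Rightarrow> real" where
  "Delta_star n = Inf {P n z | z. z 1 = 1 \<and> (\<forall>j\<in>{1..n}. 1 \<le> cmod (z j))}"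

end

theory Submission
  imports Defs "HOL-Complex_Analysis.Great_Picard" "HOL-Real_Asymp.Real_Asymp"
begin

text \<open>
  Suppose that \<open>z\<^sub>1, \<dots>, z\<^sub>n\<close> lie outside the open unit disc and that the power sums
  \<open>s\<^sub>k\<close> with \<open>2 \<le> k \<le> n + 1\<close> are at most \<open>\<epsilon> = exp (- l n)\<close> in modulus. After a rotation,
  \<open>s\<^sub>1 = - s\<close> with \<open>s \<ge> 0\<close>. Put \<open>Q(x) = \<Prod>j. (1 - z\<^sub>j x)\<close>. If those power sums were zero,
  then Newton's identities would say that \<open>Q' = s Q\<close>, which no polynomial of positive degree
  satisfies. The identities with index up to \<open>n + 1\<close> determine all the coefficients of
  \<open>Q' - s Q\<close>: its coefficient of \<open>x\<^sup>n\<close> belongs to the identity for \<open>n + 1\<close>, because \<open>Q\<close> has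
  no term of degree \<open>n + 1\<close>. Hence \<open>Q' - s Q\<close> is small as soon as these sums are small.

  The smallness is relative to \<open>Q\<close>, and this even slightly outside the unit disc. On \<open>[0, r]\<close> with
  \<open>r \<ge> 1\<close> the polynomial \<open>Q' - s Q\<close> is bounded by \<open>\<kappa> = \<epsilon> (n + 1) r\<^sup>n\<close> times the sum \<open>A\<close> of the
  absolute values of the terms of \<open>Q\<close>. The same recurrence gives \<open>A' \<le> (s + \<kappa>) A\<close>, so \<open>A\<close> grows
  hardly faster than \<open>exp (s t)\<close>, and integrating the perturbed equation shows that \<open>Q\<close> itself is
  comparable to \<open>exp (s t)\<close>. For \<open>r = exp (l / 2) > 1\<close> the number \<open>\<kappa>\<close> still tends to \<open>0\<close>, so the
  logarithmic derivative \<open>Q' / Q\<close> is nearly constant on \<open>[1, r]\<close>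
  (\<open>log_deriv_near_constant\<close>).

  This contradicts the location of the zeros \<open>x\<^sub>j = 1 / z\<^sub>j\<close> of \<open>Q\<close> in the closed unit disc. The
  function \<open>Q' / Q\<close> at \<open>1 / w\<close>, divided by \<open>n\<close>, is the average of the functions
  \<open>w / (1 - x\<^sub>j w)\<close>. Such averages are holomorphic in the open unit disc and bounded on compact
  subsets independently of \<open>n\<close> and of the \<open>x\<^sub>j\<close>; their value at \<open>0\<close> is \<open>0\<close>, while at \<open>1/4\<close>
  they are close to \<open>1/4\<close>. By Montel's theorem and the identity theorem they cannot be nearly constant
  on the fixed segment of numbers \<open>w\<close> between \<open>1 / r\<close> and a number below \<open>1\<close>
  (\<open>average_not_nearly_constant\<close>).

  The statements on \<open>Delta\<close> and \<open>Delta_star\<close> follow by comparison with the vector of ones, whose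
  power sums all equal \<open>n\<close>.
\<close>

section \<open>Newton's identities\<close>

text \<open>
  Multiplication by the geometric series of \<open>a x\<close> inverts multiplication by \<open>1 - a x\<close>.
\<close>

lemma coeff_cofactor_linear:
  fixes Q R :: "'a::comm_ring_1 poly"
  assumes "Q = [:1, - a:] * R"
  shows "coeff R m = (\<Sum>i\<le>m. coeff Q i * a ^ (m - i))"
proof (induction m)
  case 0
  show ?case using assms by simp
next
  case (Suc m)
  have "(\<Sum>i\<le>Suc m. coeff Q i * a ^ (Suc m - i)) = coeff Q (Suc m) + a * (\<Sum>i\<le>m. coeff Q i * a ^ (m - i))"
    by (auto simp: sum_distrib_left Suc_diff_le intro!: sum.cong)
  also have "\<dots> = coeff Q (Suc m) + a * coeff R m" by (simp add: Suc)
  also have "\<dots> = coeff R (Suc m)" unfolding assms by simp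
  finally show ?case ..
qed

text \<open>
  The logarithmic derivative of \<open>Q\<close> is the sum of the \<open>- z\<^sub>j / (1 - z\<^sub>j x)\<close>, whose power series has
  the power sums as coefficients. Multiplied by \<open>Q\<close>, the summands become the cofactors of the linear
  factors. The identity holds for every \<open>m\<close>, also beyond the degree of \<open>Q\<close>, where the
  left-hand side vanishes.
\<close>

lemma newton_identity:
  fixes z :: "'b \<Rightarrow> 'a::idom"
  assumes "finite A"
  defines "Q \<equiv> \<Prod>j\<in>A. [:1, - z j:]"
  shows "of_nat (Suc m) * coeff Q (Suc m) = - (\<Sum>i\<le>m. coeff Q i * (\<Sum>j\<in>A. z j ^ (Suc m - i)))"
proof -
  define R where "R j = (\<Prod>i\<in>A - {j}. [:1, - z i:])" for j
  have Q: "Q = [:1, - z j:] * R j" if "j \<in> A" for j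
    using that assms(1) unfolding Q_def R_def by (rule prod.remove[rotated])
  have "of_nat (Suc m) * coeff Q (Suc m) = coeff (pderiv Q) m"
    by (simp add: coeff_pderiv)
  also have "pderiv Q = (\<Sum>j\<in>A. R j * [:- z j:])"
    unfolding Q_def R_def pderiv_prod by (simp add: pderiv_pCons)
  also have "coeff \<dots> m = (\<Sum>j\<in>A. - (z j * coeff (R j) m))"
    by (simp add: coeff_sum)
  also have "\<dots> = (\<Sum>j\<in>A. \<Sum>i\<le>m. - (coeff Q i * z j ^ (Suc m - i)))"
  proof (rule sum.cong[OF refl])
    fix j assume "j \<in> A"
    show "- (z j * coeff (R j) m) = (\<Sum>i\<le>m. - (coeff Q i * z j ^ (Suc m - i)))"
      unfolding coeff_cofactor_linear[OF Q[OF \<open>j \<in> A\<close>]] sum_negf[symmetric] sum_distrib_left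
      by (intro sum.cong) (auto simp: Suc_diff_le)
  qed
  also have "\<dots> = - (\<Sum>i\<le>m. coeff Q i * (\<Sum>j\<in>A. z j ^ (Suc m - i)))"
    by (subst sum.swap) (simp add: sum_negf sum_distrib_left)
  finally show ?thesis .
qed

section \<open>Polynomials that nearly satisfy the equation of the exponential function\<close>

text \<open>
  The left-hand side is how the errors in a recurrence for the coefficients add up at the point
  \<open>t\<close>. Each \<open>c i\<close> occurs at most once for each of the \<open>n + 1\<close> values of \<open>m\<close>. Since
  \<open>i < m\<close>, the factor \<open>t ^ i\<close> can be split off from \<open>t ^ m\<close>, so the bound is relative to the sum on
  the right, and only the remaining power of \<open>t\<close> has to be paid for by \<open>r ^ n\<close>.
\<close>

lemma sum_lower_coeffs_le:
  fixes c :: "nat \<Rightarrow> real"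
  assumes c: "\<And>i. 0 \<le> c i" and t: "0 \<le> t" "t \<le> r" and r: "1 \<le> r"
  shows "(\<Sum>m\<le>n. (\<Sum>i<m. c i) * t ^ m) \<le> real (n + 1) * r ^ n * (\<Sum>i\<le>n. c i * t ^ i)"
proof -
  let ?A = "\<Sum>i\<le>n. c i * t ^ i"
  have "(\<Sum>i<m. c i) * t ^ m \<le> r ^ n * ?A" if "m \<le> n" for m
  proof -
    have "(\<Sum>i<m. c i) * t ^ m \<le> (\<Sum>i<m. r ^ n * (c i * t ^ i))"
      unfolding sum_distrib_right
    proof (rule sum_mono)
      fix i assume "i \<in> {..<m}"
      then have i: "i < m" by simp
      have "t ^ (m - i) \<le> r ^ (m - i)"
        using t by (intro power_mono)
      also have "\<dots> \<le> r ^ n"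
        using that r by (intro power_increasing) auto
      finally have "c i * t ^ i * t ^ (m - i) \<le> c i * t ^ i * r ^ n"
        using c t by (intro mult_left_mono) auto
      moreover have "t ^ m = t ^ i * t ^ (m - i)"
        using i by (simp flip: power_add)
      ultimately show "c i * t ^ m \<le> r ^ n * (c i * t ^ i)"
        by (simp add: mult_ac)
    qed
    also have "\<dots> \<le> (\<Sum>i\<le>n. r ^ n * (c i * t ^ i))"
      using that c t r by (intro sum_mono2) auto
    finally show ?thesis by (simp add: sum_distrib_left)
  qed
  then have "(\<Sum>m\<le>n. (\<Sum>i<m. c i) * t ^ m) \<le> (\<Sum>m\<le>n. r ^ n * ?A)"
    by (intro sum_mono) auto
  then show ?thesis by (simp add: mult_ac)
qed

lemma poly_eq_sum_upto:
  fixes p :: "'a::comm_semiring_1 poly"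
  assumes "degree p \<le> n"
  shows "poly p x = (\<Sum>i\<le>n. coeff p i * x ^ i)"
  unfolding poly_altdef using assms
  by (intro sum.mono_neutral_left) (auto simp: coeff_eq_0)

text \<open>The differential form of Gronwall's inequality: \<open>A t * exp (- L * t)\<close> is nonincreasing.\<close>

lemma exp_growth_from_deriv_le:
  fixes A A' :: "real \<Rightarrow> real"
  assumes "\<And>t. (A has_real_derivative A' t) (at t)"
    and "\<And>t. 0 \<le> t \<Longrightarrow> t \<le> r \<Longrightarrow> A' t \<le> L * A t"
    and t: "0 \<le> t" "t \<le> r"
  shows "A t \<le> A 0 * exp (L * t)"
proof -
  define B where "B t = A t * exp (- L * t)" for t
  have "(B has_real_derivative (A' u - L * A u) * exp (- L * u)) (at u)" for u
    unfolding B_def by (auto intro!: derivative_eq_intros assms(1) simp: algebra_simps)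
  moreover have "(A' u - L * A u) * exp (- L * u) \<le> 0" if "0 \<le> u" "u \<le> t" for u
    using assms(2)[of u] that t by (intro mult_nonpos_nonneg) auto
  ultimately have "B t \<le> B 0"
    using t by (intro DERIV_nonpos_imp_nonincreasing[of 0 t B]) blast+
  then show ?thesis
    by (simp add: B_def exp_minus field_simps)
qed

text \<open>
  The recurrence says that \<open>Q' - s Q\<close> has small coefficients. To turn this into a statement on
  \<open>Q' / Q\<close> one needs \<open>\<bar>Q' - s Q\<bar>\<close> to be small compared with \<open>\<bar>Q\<bar>\<close>, which has size \<open>exp (s t)\<close>. A
  bound by \<open>\<epsilon>\<close> times the sum of all \<open>\<bar>coeff Q i\<bar>\<close>, hence of size \<open>\<epsilon> exp s\<close>, would be useless for small
  \<open>t\<close>, where \<open>Q\<close> is close to \<open>1\<close>. This is why the majorant \<open>A t\<close> of \<open>\<bar>Q t\<bar>\<close> is carried along as a function of \<open>t\<close>. On the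
  positive real axis \<open>A\<close> and \<open>Q\<close> are both of size \<open>exp (s t)\<close>; the assumption that \<open>s\<close> is real
  and nonnegative ensures this.
\<close>

lemma log_deriv_near_constant:
  fixes Q :: "complex poly" and s \<epsilon> r :: real
  assumes deg: "degree Q \<le> n" and Q0: "coeff Q 0 = 1" and \<epsilon>: "0 \<le> \<epsilon>" and s: "0 \<le> s" and r: "1 \<le> r"
    and rec: "\<And>m. m \<le> n \<Longrightarrow>
       cmod (of_nat (Suc m) * coeff Q (Suc m) - s * coeff Q m) \<le> \<epsilon> * (\<Sum>i<m. cmod (coeff Q i))"
  defines "\<kappa> \<equiv> \<epsilon> * (real (n + 1) * r ^ n)"
  assumes small: "\<kappa> * exp (\<kappa> * r) * r \<le> 1 / 2"
    and t: "0 \<le> t" "t \<le> r"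
  shows "poly Q t \<noteq> 0"
    and "cmod (poly (pderiv Q) t / poly Q t - s) \<le> 2 * (\<kappa> * exp (\<kappa> * r))"
proof -
  define c where "c m = cmod (coeff Q m)" for m
  define A where "A t = (\<Sum>m\<le>n. c m * t ^ m)" for t :: real
  define A' where "A' t = (\<Sum>m\<le>n. c m * (real m * t ^ (m - 1)))" for t :: real
  have c: "0 \<le> c m" for m by (simp add: c_def)
  have \<kappa>: "0 \<le> \<kappa>" unfolding \<kappa>_def using \<epsilon> r by simp
  have cn: "coeff Q (Suc n) = 0" using deg by (simp add: coeff_eq_0)
  have lower: "(\<Sum>m\<le>n. \<epsilon> * (\<Sum>i<m. c i) * u ^ m) \<le> \<kappa> * A u" if "0 \<le> u" "u \<le> r" for u
    using mult_left_mono[OF sum_lower_coeffs_le[of c u r n, OF c that r] \<epsilon>]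
    by (simp add: \<kappa>_def A_def sum_distrib_left mult_ac)
  have der: "(A has_real_derivative A' u) (at u)" for u
    unfolding A_def A'_def by (auto intro!: derivative_eq_intros sum.cong simp: mult_ac)
  have A'_le: "A' u \<le> (s + \<kappa>) * A u" if u: "0 \<le> u" "u \<le> r" for u
  proof -
    \<comment> \<open>The vanishing term of index \<open>n + 1\<close> is added so that after the shift the recurrence applies
      to all \<open>m \<le> n\<close>.\<close>
    have "A' u = (\<Sum>m\<le>Suc n. c m * (real m * u ^ (m - 1)))"
      unfolding A'_def using cn by (simp add: c_def)
    also have "\<dots> = (\<Sum>m\<le>n. real (Suc m) * c (Suc m) * u ^ m)"
      by (subst sum.atMost_Suc_shift) (simp add: mult_ac)
    also have "\<dots> \<le> (\<Sum>m\<le>n. (s * c m + \<epsilon> * (\<Sum>i<m. c i)) * u ^ m)"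
    proof (intro sum_mono mult_right_mono)
      fix m assume "m \<in> {..n}"
      then have m: "m \<le> n" by simp
      have "cmod (of_nat (Suc m) * coeff Q (Suc m)) \<le> cmod (s * coeff Q m)
          + cmod (of_nat (Suc m) * coeff Q (Suc m) - s * coeff Q m)"
        by (rule norm_triangle_sub)
      also have "\<dots> \<le> s * c m + \<epsilon> * (\<Sum>i<m. c i)"
        using rec[OF m] s by (simp add: c_def norm_mult)
      finally show "real (Suc m) * c (Suc m) \<le> s * c m + \<epsilon> * (\<Sum>i<m. c i)"
        by (simp only: norm_mult norm_of_nat c_def)
    qed (use u in simp)
    also have "\<dots> = s * A u + (\<Sum>m\<le>n. \<epsilon> * (\<Sum>i<m. c i) * u ^ m)"
      by (simp add: A_def sum.distrib sum_distrib_left algebra_simps)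
    also have "\<dots> \<le> (s + \<kappa>) * A u"
      using lower[OF u] by (simp add: algebra_simps)
    finally show ?thesis .
  qed
  have A_le: "A u \<le> exp ((s + \<kappa>) * u)" if "0 \<le> u" "u \<le> r" for u
  proof -
    have "A 0 = 1" unfolding A_def by (simp add: c_def Q0 power_0_left if_distrib sum.delta cong: if_cong)
    then show ?thesis
      using exp_growth_from_deriv_le[of A A' r "s + \<kappa>" u] der A'_le that by simp
  qed
  have D_le: "cmod (poly (pderiv Q) u - s * poly Q u) \<le> \<kappa> * A u" if u: "0 \<le> u" "u \<le> r" for u :: real
  proof -
    define D where "D = pderiv Q - smult (of_real s) Q"
    have "degree D \<le> n" unfolding D_def
      using deg by (intro degree_diff_le) (auto intro: order_trans[OF degree_smult_le] simp: degree_pderiv)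
    then have "poly (pderiv Q) u - s * poly Q u = (\<Sum>m\<le>n. coeff D m * of_real u ^ m)"
      by (subst poly_eq_sum_upto[symmetric]) (auto simp: D_def)
    also have "cmod \<dots> \<le> (\<Sum>m\<le>n. cmod (coeff D m * of_real u ^ m))"
      by (rule norm_sum)
    also have "\<dots> \<le> (\<Sum>m\<le>n. \<epsilon> * (\<Sum>i<m. c i) * u ^ m)"
      using rec u by (intro sum_mono) (auto simp: D_def coeff_pderiv norm_mult norm_power c_def intro!: mult_right_mono)
    finally show ?thesis using lower[OF u] by linarith
  qed
  have E_le: "cmod (poly (pderiv Q) u - s * poly Q u) \<le> \<kappa> * exp (\<kappa> * r) * exp (s * u)"
    if u: "0 \<le> u" "u \<le> r" for u :: real
  proof -
    have "A u \<le> exp (\<kappa> * r) * exp (s * u)"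
    proof (rule order_trans[OF A_le[OF u]])
      have "\<kappa> * u \<le> \<kappa> * r" using u \<kappa> by (intro mult_left_mono)
      then show "exp ((s + \<kappa>) * u) \<le> exp (\<kappa> * r) * exp (s * u)"
        by (simp add: algebra_simps flip: exp_add)
    qed
    then show ?thesis
      using D_le[OF u] mult_left_mono[OF _ \<kappa>] by (fastforce simp: mult_ac)
  qed
  \<comment> \<open>The derivative of \<open>F\<close> is \<open>(Q' - s Q) exp (- s x)\<close>, so \<open>E_le\<close> keeps \<open>F\<close> close to \<open>F 0 = 1\<close>.\<close>
  define F where "F x = poly Q x * exp (- s * x)" for x :: complex
  have "cmod (F t - F 0) \<le> \<kappa> * exp (\<kappa> * r) * cmod (of_real t - 0)"
  proof (rule field_differentiable_bound)
    show "convex (closed_segment 0 (complex_of_real t))" by simp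
    fix x assume "x \<in> closed_segment 0 (complex_of_real t)"
    then obtain v where v: "0 \<le> v" "v \<le> 1" "x = of_real (v * t)"
      by (auto simp: in_segment scaleR_conv_of_real)
    define u where "u = v * t"
    have u: "0 \<le> u" "u \<le> r"
      using v t mult_right_mono[of v 1 t] by (auto simp: u_def)
    show "(F has_field_derivative (poly (pderiv Q) x - s * poly Q x) * exp (- s * x))
        (at x within closed_segment 0 (complex_of_real t))"
      unfolding F_def by (auto intro!: derivative_eq_intros has_field_derivative_at_within[OF poly_DERIV] simp: algebra_simps)
    have "cmod (exp (- s * x)) = exp (- s * u)"
      by (simp add: v(3) u_def)
    then have "cmod ((poly (pderiv Q) x - s * poly Q x) * exp (- s * x))
        \<le> \<kappa> * exp (\<kappa> * r) * exp (s * u) * exp (- s * u)"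
      using E_le[OF u] v(3) by (simp add: norm_mult u_def)
    also have "\<dots> = \<kappa> * exp (\<kappa> * r)"
      by (simp add: exp_minus)
    finally show "cmod ((poly (pderiv Q) x - s * poly Q x) * exp (- s * x)) \<le> \<kappa> * exp (\<kappa> * r)" .
  qed auto
  also have "\<dots> \<le> \<kappa> * exp (\<kappa> * r) * r"
    using t \<kappa> by (intro mult_left_mono) auto
  also have "\<dots> \<le> 1 / 2" by (rule small)
  finally have "cmod (F t - 1) \<le> 1 / 2"
    by (simp add: F_def poly_0_coeff_0 Q0)
  then have "1 / 2 \<le> cmod (F t)"
    using norm_triangle_ineq2[of 1 "1 - F t"] by (simp add: norm_minus_commute)
  then have Q_ge: "exp (s * t) / 2 \<le> cmod (poly Q t)"
    by (simp add: F_def norm_mult norm_divide exp_minus field_simps)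
  then show nz: "poly Q t \<noteq> 0"
    using exp_gt_zero[of "s * t"] by (auto simp del: exp_gt_zero)
  have "cmod (poly (pderiv Q) t / poly Q t - s) = cmod (poly (pderiv Q) t - s * poly Q t) / cmod (poly Q t)"
    using nz by (simp add: norm_divide[symmetric] diff_divide_distrib)
  also have "\<dots> \<le> \<kappa> * exp (\<kappa> * r) * exp (s * t) / (exp (s * t) / 2)"
    using E_le[OF t] Q_ge \<kappa> by (intro frac_le) auto
  also have "\<dots> = 2 * (\<kappa> * exp (\<kappa> * r))" by simp
  finally show "cmod (poly (pderiv Q) t / poly Q t - s) \<le> 2 * (\<kappa> * exp (\<kappa> * r))" .
qed

section \<open>Functions that are nearly constant on a small set\<close>

text \<open>
  If members \<open>g\<^sub>k\<close> of the family were closer and closer to constants on \<open>U\<close>, then a limit of the functions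
  \<open>g\<^sub>k - g\<^sub>k \<xi>\<close>, which exists by Montel's theorem, would vanish on \<open>U\<close> and hence on all of
  \<open>S\<close>, against the oscillation between \<open>p\<close> and \<open>q\<close>. Subtracting \<open>g\<^sub>k \<xi>\<close> instead of the
  constant \<open>\<sigma>\<close> keeps the family locally bounded although the \<open>\<sigma>\<close> are arbitrary.
\<close>

lemma normal_family_not_nearly_constant:
  assumes S: "open S" "connected S"
    and hol: "\<And>g. g \<in> \<G> \<Longrightarrow> g holomorphic_on S"
    and bdd: "\<And>K. compact K \<Longrightarrow> K \<subseteq> S \<Longrightarrow> \<exists>B. \<forall>g\<in>\<G>. \<forall>w\<in>K. cmod (g w) \<le> B"
    and U: "U \<subseteq> S" "\<xi> \<in> U" "\<xi> islimpt U"
    and pq: "p \<in> S" "q \<in> S" "0 < \<delta>" "\<And>g. g \<in> \<G> \<Longrightarrow> \<delta> \<le> cmod (g p - g q)"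
  shows "\<exists>\<eta>>0. \<forall>g\<in>\<G>. \<forall>\<sigma>. \<exists>w\<in>U. \<eta> < cmod (g w - \<sigma>)"
proof (rule ccontr)
  assume neg: "\<not> ?thesis"
  have "\<exists>g\<in>\<G>. \<exists>\<sigma>. \<forall>w\<in>U. cmod (g w - \<sigma>) \<le> 1 / real (Suc k)" for k
    using neg by (force simp: not_less dest: spec[of _ "1 / real (Suc k)"])
  then obtain g \<sigma> where g: "\<And>k. g k \<in> \<G>"
    and g\<sigma>: "\<And>k w. w \<in> U \<Longrightarrow> cmod (g k w - \<sigma> k) \<le> 1 / real (Suc k)"
    by metis
  define H where "H k w = g k w - g k \<xi>" for k w
  define \<H> where "\<H> = {\<lambda>w. h w - h \<xi> | h. h \<in> \<G>}"
  obtain G \<rho> where G: "G holomorphic_on S" and \<rho>: "strict_mono (\<rho> :: nat \<Rightarrow> nat)"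
    and lim: "\<And>w. w \<in> S \<Longrightarrow> (\<lambda>k. H (\<rho> k) w) \<longlonglongrightarrow> G w"
  proof (rule Montel[OF S(1), of \<H> H])
    show "h holomorphic_on S" if "h \<in> \<H>" for h
    proof -
      from that obtain h' where "h' \<in> \<G>" "h = (\<lambda>w. h' w - h' \<xi>)" by (auto simp: \<H>_def)
      then show ?thesis by (auto intro!: holomorphic_intros dest: hol)
    qed
    show "range H \<subseteq> \<H>"
      using g by (auto simp: \<H>_def H_def[abs_def])
    show "\<exists>B. \<forall>h\<in>\<H>. \<forall>w\<in>K. cmod (h w) \<le> B" if K: "compact K" "K \<subseteq> S" for K
    proof -
      obtain B where B: "\<forall>g\<in>\<G>. \<forall>w\<in>insert \<xi> K. cmod (g w) \<le> B"
        using bdd[of "insert \<xi> K"] K U by auto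
      have "cmod (h w - h \<xi>) \<le> B + B" if "h \<in> \<G>" "w \<in> K" for h w
        using B that by (intro order_trans[OF norm_triangle_ineq4] add_mono) auto
      then show ?thesis by (auto simp: \<H>_def)
    qed
  qed blast
  have H_le: "cmod (H k w) \<le> 2 / real (Suc k)" if "w \<in> U" for k w
  proof -
    have "H k w = (g k w - \<sigma> k) - (g k \<xi> - \<sigma> k)" by (simp add: H_def)
    then have "cmod (H k w) \<le> cmod (g k w - \<sigma> k) + cmod (g k \<xi> - \<sigma> k)"
      by (metis norm_triangle_ineq4)
    also have "\<dots> \<le> 1 / real (Suc k) + 1 / real (Suc k)"
      using that U by (intro add_mono g\<sigma>)
    finally show ?thesis by simp
  qed
  have GU: "G w = 0" if "w \<in> U" for w
  proof -
    have "(\<lambda>k. H k w) \<longlonglongrightarrow> 0"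
    proof (rule Lim_null_comparison)
      show "\<forall>\<^sub>F k in sequentially. cmod (H k w) \<le> 2 / real (Suc k)"
        using H_le[OF that] by simp
      show "(\<lambda>k. 2 / real (Suc k)) \<longlonglongrightarrow> 0" by real_asymp
    qed
    then have "(\<lambda>k. H (\<rho> k) w) \<longlonglongrightarrow> 0"
      using LIMSEQ_subseq_LIMSEQ[OF _ \<rho>] by (simp add: o_def)
    then show ?thesis
      using lim[of w] that U LIMSEQ_unique by blast
  qed
  have G0: "G w = 0" if "w \<in> S" for w
    using analytic_continuation[OF G S U(1) _ U(3) GU that] U by auto
  have "(\<lambda>k. cmod (H (\<rho> k) p - H (\<rho> k) q)) \<longlonglongrightarrow> cmod (G p - G q)"
    by (intro tendsto_intros lim pq)
  then have "\<delta> \<le> cmod (G p - G q)"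
    by (rule LIMSEQ_le_const) (use pq(4) g in \<open>auto simp: H_def\<close>)
  then show False using G0 pq by simp
qed

text \<open>
  What matters is that \<open>\<eta>\<close> depends neither on the number of points nor on their position. An average inherits
  every estimate that holds for the single functions \<open>w / (1 - x w)\<close> with \<open>\<bar>x\<bar> \<le> 1\<close>: the bound
  \<open>1 / (1 - \<bar>w\<bar>)\<close>, which makes the family normal, and the distance at most \<open>1/12\<close> from \<open>1/4\<close> at the
  point \<open>w = 1/4\<close>, which keeps the value there away from the value \<open>0\<close> at \<open>w = 0\<close>.
\<close>

lemma average_not_nearly_constant:
  fixes b c :: real
  assumes bc: "0 < b" "b < c" "c < 1"
  shows "\<exists>\<eta>>0. \<forall>(A :: 'a set) x \<sigma>. finite A \<longrightarrow> A \<noteq> {} \<longrightarrow> (\<forall>j\<in>A. cmod (x j) \<le> 1) \<longrightarrow>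
    (\<exists>w\<in>{b..c}. \<eta> < cmod ((\<Sum>j\<in>A. w / (1 - x j * w)) / card A - \<sigma>))"
proof -
  define g where "g A x w = (\<Sum>j\<in>A. w / (1 - x j * w)) / complex_of_nat (card A)"
    for A :: "'a set" and x w
  define \<G> where "\<G> = {g A x | A x. finite A \<and> A \<noteq> {} \<and> (\<forall>j\<in>A. cmod (x j) \<le> 1)}"
  have xw: "cmod (x * w) \<le> cmod w" if "cmod x \<le> 1" for x w :: complex
    using that by (simp add: norm_mult mult_left_le_one_le)
  have den: "1 - cmod w \<le> cmod (1 - x * w)" if "cmod x \<le> 1" for x w :: complex
    using norm_triangle_ineq2[of 1 "x * w"] xw[OF that, of w] by simp
  have nz: "1 - x * w \<noteq> 0" if "cmod x \<le> 1" "cmod w < 1" for x w :: complex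
    using den[OF that(1), of w] that by auto
  have avg: "cmod (g A x w - v) \<le> B"
    if "finite A" "A \<noteq> {}" "\<And>j. j \<in> A \<Longrightarrow> cmod (w / (1 - x j * w) - v) \<le> B" for A x w v B
  proof -
    have "g A x w - v = (\<Sum>j\<in>A. w / (1 - x j * w) - v) / card A"
      using that by (simp add: g_def sum_subtractf diff_divide_distrib)
    also have "cmod \<dots> \<le> (\<Sum>j\<in>A. B) / card A"
      unfolding norm_divide norm_of_nat using that(3)
      by (intro divide_right_mono sum_norm_le) auto
    finally show ?thesis using that by simp
  qed
  have "\<exists>\<eta>>0. \<forall>h\<in>\<G>. \<forall>\<sigma>. \<exists>w\<in>closed_segment (of_real b) (of_real c). \<eta> < cmod (h w - \<sigma>)"
  proof (rule normal_family_not_nearly_constant[where S = "ball 0 1" and \<xi> = "of_real b" and \<delta> = "1/6"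
        and p = "1/4" and q = 0])
    show "h holomorphic_on ball 0 1" if "h \<in> \<G>" for h
      using that nz by (auto simp: \<G>_def g_def[abs_def] intro!: holomorphic_intros)
    show "\<exists>B. \<forall>h\<in>\<G>. \<forall>w\<in>K. cmod (h w) \<le> B" if K: "compact K" "K \<subseteq> ball 0 1" for K
    proof (cases "K = {}")
      case False
      obtain w0 where w0: "w0 \<in> K" "\<And>w. w \<in> K \<Longrightarrow> cmod w \<le> cmod w0"
        using continuous_attains_sup[OF K(1) False continuous_on_norm_id] by auto
      have "cmod (h w) \<le> 1 / (1 - cmod w0)" if "h \<in> \<G>" "w \<in> K" for h w
      proof -
        obtain A x where A: "h = g A x" "finite A" "A \<noteq> {}" "\<forall>j\<in>A. cmod (x j) \<le> 1"
          using \<open>h \<in> \<G>\<close> unfolding \<G>_def by blast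
        have "cmod (w / (1 - x j * w) - 0) \<le> 1 / (1 - cmod w0)" if "j \<in> A" for j
          unfolding diff_0_right norm_divide
          using w0(2)[OF \<open>w \<in> K\<close>] w0(1) K den[of "x j" w] A that by (intro frac_le) auto
        then show ?thesis using avg[of A w x 0] A by simp
      qed
      then show ?thesis by blast
    qed auto
    show "closed_segment (of_real b) (of_real c) \<subseteq> ball (0::complex) 1"
      using bc by (intro closed_segment_subset) auto
    show "complex_of_real b islimpt closed_segment (of_real b) (of_real c)"
      proof (rule connected_imp_perfect)
      show "closed_segment (of_real b) (of_real c) \<noteq> {x}" for x :: complex
      proof
        assume "closed_segment (of_real b) (of_real c) = {x}"
        then have "complex_of_real b = x" "complex_of_real c = x"
          using ends_in_segment(1,2)[where 'a = complex] by blast+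
        then show False using bc by auto
      qed
    qed auto
    show "1/6 \<le> cmod (h (1/4) - h 0)" if "h \<in> \<G>" for h
    proof -
      obtain A x where A: "h = g A x" "finite A" "A \<noteq> {}" "\<forall>j\<in>A. cmod (x j) \<le> 1"
        using \<open>h \<in> \<G>\<close> unfolding \<G>_def by blast
      have "cmod ((1/4) / (1 - x j * (1/4)) - 1/4) \<le> 1/12" if "j \<in> A" for j
      proof -
        have "(1/4) / (1 - x j * (1/4)) - 1/4 = (x j / 16) / (1 - x j * (1/4))"
          using nz[of "x j" "1/4"] A that by (simp add: field_simps)
        also have "cmod \<dots> \<le> (1/16) / (3/4)"
          unfolding norm_divide using den[of "x j" "1/4"] A that by (intro frac_le) auto
        finally show ?thesis by simp
      qed
      then have "cmod (h (1/4) - 1/4) \<le> 1/12"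
        unfolding A(1) by (rule avg[OF A(2,3)])
      moreover have "h 0 = 0" by (simp add: A g_def)
      ultimately show ?thesis
        using norm_triangle_ineq2[of "1/4" "1/4 - h (1/4)"] by (simp add: norm_minus_commute)
    qed
  qed auto
  then obtain \<eta> where \<eta>: "\<eta> > 0"
    "\<And>h \<sigma>. h \<in> \<G> \<Longrightarrow> \<exists>w\<in>closed_segment (of_real b) (of_real c). \<eta> < cmod (h w - \<sigma>)"
    by blast
  have seg: "closed_segment (of_real b) (of_real c) = complex_of_real ` {b..c}"
    using bc by (simp add: closed_segment_of_real closed_segment_eq_real_ivl)
  have "\<exists>w\<in>{b..c}. \<eta> < cmod (g A x w - \<sigma>)" if "finite A" "A \<noteq> {}" "\<forall>j\<in>A. cmod (x j) \<le> 1" for A x \<sigma>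
  proof -
    have "g A x \<in> \<G>" using that by (auto simp: \<G>_def)
    from \<eta>(2)[OF this, of \<sigma>] show ?thesis unfolding seg by auto
  qed
  then show ?thesis using \<eta>(1) unfolding g_def by blast
qed

section \<open>Power sums of numbers outside the unit disc\<close>

text \<open>
  Small power sums force the opposite behaviour. The interval \<open>[1/r, 1]\<close> for \<open>w\<close> corresponds to
  \<open>t = 1 / w\<close> in \<open>[1, r]\<close>, the part of the range of \<open>log_deriv_near_constant\<close> that lies outside the
  unit disc.
\<close>

lemma average_near_constant:
  fixes z :: "'a \<Rightarrow> complex"
  assumes A: "finite A" "A \<noteq> {}" and z: "\<And>j. j \<in> A \<Longrightarrow> 1 \<le> cmod (z j)"
    and \<epsilon>: "0 \<le> \<epsilon>" and r: "1 \<le> r"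
    and sums: "\<And>k. k \<in> {2..card A + 1} \<Longrightarrow> cmod (\<Sum>j\<in>A. z j ^ k) \<le> \<epsilon>"
  defines "\<kappa> \<equiv> \<epsilon> * (real (card A + 1) * r ^ card A)"
  assumes small: "\<kappa> * exp (\<kappa> * r) * r \<le> 1 / 2"
  shows "\<exists>x \<sigma>. (\<forall>j\<in>A. cmod (x j) \<le> 1) \<and>
    (\<forall>w\<in>{1/r..1}. cmod ((\<Sum>j\<in>A. w / (1 - x j * w)) / card A - \<sigma>) \<le> 2 * (\<kappa> * exp (\<kappa> * r)))"
proof -
  let ?n = "card A"
  define s where "s = cmod (\<Sum>j\<in>A. z j)"
  \<comment> \<open>Rotating all the numbers by \<open>u\<close> makes the first power sum nonpositive and keeps the moduli of the
    other ones.\<close>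
  obtain u where u: "cmod u = 1" "u * (\<Sum>j\<in>A. z j) = - of_real s"
  proof (cases "s = 0")
    case True
    then show ?thesis by (intro that[of 1]) (auto simp: s_def)
  next
    case False
    then show ?thesis
      by (intro that[of "- of_real s / (\<Sum>j\<in>A. z j)"]) (auto simp: s_def norm_divide)
  qed
  define y where "y j = u * z j" for j
  have y1: "(\<Sum>j\<in>A. y j) = - of_real s"
    using u(2) by (simp add: y_def sum_distrib_left)
  have yk: "cmod (\<Sum>j\<in>A. y j ^ k) \<le> \<epsilon>" if "k \<in> {2..?n + 1}" for k
    using sums[OF that] u(1) by (simp add: y_def power_mult_distrib norm_mult norm_power flip: sum_distrib_left)
  have y_ge: "1 \<le> cmod (y j)" if "j \<in> A" for j
    using z[OF that] u(1) by (simp add: y_def norm_mult)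
  define Q where "Q = (\<Prod>j\<in>A. [:1, - y j:])"
  have deg: "degree Q \<le> ?n"
  proof -
    have "degree Q \<le> (\<Sum>j\<in>A. degree [:1, - y j:])"
      unfolding Q_def using degree_prod_sum_le[OF A(1), of "\<lambda>j. [:1, - y j:]"] by (simp add: o_def)
    also have "\<dots> \<le> (\<Sum>j\<in>A. 1)" by (intro sum_mono) simp
    finally show ?thesis by simp
  qed
  have Q0: "coeff Q 0 = 1"
    by (simp add: Q_def poly_prod flip: poly_0_coeff_0)
  have rec: "cmod (of_nat (Suc m) * coeff Q (Suc m) - s * coeff Q m) \<le> \<epsilon> * (\<Sum>i<m. cmod (coeff Q i))"
    if "m \<le> ?n" for m
  proof -
    have "of_nat (Suc m) * coeff Q (Suc m) - s * coeff Q m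
        = - (\<Sum>i<m. coeff Q i * (\<Sum>j\<in>A. y j ^ (Suc m - i)))"
      unfolding Q_def newton_identity[OF A(1)]
      by (simp add: y1 lessThan_Suc_atMost[symmetric] del: of_nat_Suc)
    also have "cmod \<dots> \<le> (\<Sum>i<m. cmod (coeff Q i) * \<epsilon>)"
      unfolding norm_minus_cancel
      by (intro sum_norm_le) (use that in \<open>auto simp: norm_mult intro!: mult_left_mono yk\<close>)
    finally show ?thesis by (simp add: sum_distrib_left mult_ac)
  qed
  have main: "poly Q t \<noteq> 0" "cmod (poly (pderiv Q) t / poly Q t - s) \<le> 2 * (\<kappa> * exp (\<kappa> * r))"
    if "0 \<le> t" "t \<le> r" for t
    using log_deriv_near_constant[OF deg Q0 \<epsilon> _ r rec _ that] small
    by (auto simp: \<kappa>_def s_def)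
  have logd: "poly (pderiv Q) t / poly Q t = (\<Sum>j\<in>A. - y j / (1 - y j * t))" if "poly Q t \<noteq> 0" for t
  proof -
    have "poly (pderiv Q) t = (\<Sum>j\<in>A. poly (\<Prod>i\<in>A - {j}. [:1, - y i:]) t * - y j)"
      unfolding Q_def pderiv_prod by (simp add: pderiv_pCons poly_sum mult_ac)
    also have "\<dots> = (\<Sum>j\<in>A. poly Q t * (- y j / (1 - y j * t)))"
    proof (rule sum.cong[OF refl])
      fix j assume j: "j \<in> A"
      have "Q = [:1, - y j:] * (\<Prod>i\<in>A - {j}. [:1, - y i:])"
        unfolding Q_def using A(1) j by (rule prod.remove)
      then have "poly Q t = (1 - y j * t) * poly (\<Prod>i\<in>A - {j}. [:1, - y i:]) t"
        by (simp only: poly_mult) (simp add: mult_ac)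
      with that show "poly (\<Prod>i\<in>A - {j}. [:1, - y i:]) t * - y j = poly Q t * (- y j / (1 - y j * t))"
        by auto
    qed
    finally show ?thesis using that unfolding sum_distrib_left[symmetric] by simp
  qed
  show ?thesis
  proof (intro exI conjI ballI)
    show "cmod (1 / y j) \<le> 1" if "j \<in> A" for j
      using y_ge[OF that] by (simp add: norm_divide divide_le_eq_1)
    fix w :: real assume w: "w \<in> {1/r..1}"
    have w0: "0 < w" using w r by (auto intro: less_le_trans[of 0 "1/r"])
    define t where "t = 1 / w"
    have t: "0 \<le> t" "t \<le> r" using w w0 r by (auto simp: t_def field_simps)
    have "w / (1 - 1 / y j * w) = - y j / (1 - y j * t)" if "j \<in> A" for j
    proof -
      have "y j \<noteq> 0" using y_ge[OF that] by auto
      moreover have "y j \<noteq> w"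
        using main(1)[OF t] that A(1) w0 by (auto simp: Q_def poly_prod t_def)
      ultimately show ?thesis using w0 by (simp add: t_def divide_simps) (auto simp: algebra_simps)
    qed
    then have "(\<Sum>j\<in>A. w / (1 - 1 / y j * w)) = poly (pderiv Q) t / poly Q t"
      using logd[OF main(1)[OF t]] by simp
    then have "cmod ((\<Sum>j\<in>A. w / (1 - 1 / y j * w)) / ?n - s / ?n)
        = cmod (poly (pderiv Q) t / poly Q t - s) / ?n"
      by (simp only: diff_divide_distrib[symmetric] norm_divide norm_of_nat of_real_divide of_real_of_nat_eq)
    also have "\<dots> \<le> cmod (poly (pderiv Q) t / poly Q t - s) / 1"
    proof (intro divide_left_mono)
      show "1 \<le> real ?n" using A by (simp add: Suc_le_eq card_gt_0_iff)
    qed (use A in \<open>auto simp: card_gt_0_iff\<close>)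
    also have "\<dots> \<le> 2 * (\<kappa> * exp (\<kappa> * r))" using main(2)[OF t] by simp
    finally show "cmod ((\<Sum>j\<in>A. w / (1 - 1 / y j * w)) / ?n - of_real (s / ?n)) \<le> 2 * (\<kappa> * exp (\<kappa> * r))"
      by simp
  qed
qed

text \<open>
  The radius \<open>r = exp (l / 2)\<close> exceeds \<open>1\<close>, yet \<open>r ^ n\<close> loses only half of the exponent \<open>l * n\<close>. This
  leaves room for \<open>\<kappa>\<close> to tend to \<open>0\<close>, and hence to fall below the \<open>\<eta>\<close> that belongs to a fixed
  subinterval of \<open>[1/r, 1)\<close>.
\<close>

theorem power_sums_not_exponentially_small:
  fixes l :: real
  assumes l: "l > 0"
  shows "\<exists>N. \<forall>n\<ge>N. n \<ge> 1 \<longrightarrow> (\<forall>z::nat \<Rightarrow> complex. (\<forall>j\<in>{1..n}. 1 \<le> cmod (z j)) \<longrightarrow> P n z > exp (- l * real n))"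
proof -
  define r where "r = exp (l / 2)"
  define \<kappa> where "\<kappa> n = exp (- l * real n) * (real (n + 1) * r ^ n)" for n
  have r: "1 < r" using l by (simp add: r_def)
  obtain \<eta> where \<eta>: "\<eta> > 0" and avg: "\<And>(A :: nat set) x \<sigma>. finite A \<Longrightarrow> A \<noteq> {} \<Longrightarrow> (\<forall>j\<in>A. cmod (x j) \<le> 1) \<Longrightarrow>
    (\<exists>w\<in>{1/r..(1/r+1)/2}. \<eta> < cmod ((\<Sum>j\<in>A. w / (1 - x j * w)) / card A - \<sigma>))"
  proof -
    have "0 < 1/r" "1/r < (1/r+1)/2" "(1/r+1)/2 < 1"
      using r by (simp_all add: field_simps)
    from average_not_nearly_constant[OF this, where 'a = nat] show ?thesis
      using that by blast
  qed
  have "r ^ n = exp (l * real n / 2)" for n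
    by (simp add: r_def flip: exp_of_nat_mult)
  then have "\<kappa> = (\<lambda>n. real (n + 1) * exp (- l * real n / 2))"
    by (auto simp: \<kappa>_def fun_eq_iff simp flip: exp_add)
  moreover have "(\<lambda>n. real (n + 1) * exp (- l * real n / 2)) \<longlonglongrightarrow> 0"
    using l by real_asymp
  ultimately have \<kappa>: "\<kappa> \<longlonglongrightarrow> 0" by simp
  have "(\<lambda>n. \<kappa> n * exp (\<kappa> n * r)) \<longlonglongrightarrow> 0 * exp (0 * r)"
    by (intro tendsto_intros \<kappa>)
  then have "\<forall>\<^sub>F n in sequentially. \<kappa> n * exp (\<kappa> n * r) < min (\<eta> / 2) (1 / (2 * r))"
    by (rule order_tendstoD) (use \<eta> r in auto)
  then obtain N where N: "\<And>n. n \<ge> N \<Longrightarrow> \<kappa> n * exp (\<kappa> n * r) < min (\<eta> / 2) (1 / (2 * r))"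
    by (auto simp: eventually_at_top_linorder)
  have "P n z > exp (- l * real n)" if n: "n \<ge> N" "n \<ge> 1" and z: "\<forall>j\<in>{1..n}. 1 \<le> cmod (z j)" for n z
  proof (rule ccontr)
    assume "\<not> ?thesis"
    have le: "cmod (\<Sum>j=1..n. z j ^ k) \<le> exp (- l * real n)" if "k \<in> {2..n+1}" for k
    proof -
      have "cmod (\<Sum>j=1..n. z j ^ k) \<le> P n z"
        unfolding P_def using that by (intro Max_ge) auto
      with \<open>\<not> P n z > exp (- l * real n)\<close> show ?thesis by linarith
    qed
    have "\<kappa> n * exp (\<kappa> n * r) * r \<le> 1 / 2"
      using N[OF n(1)] r by (simp add: field_simps)
    then obtain x \<sigma> where x: "\<forall>j\<in>{1..n}. cmod (x j) \<le> 1" and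
      w: "\<forall>w\<in>{1/r..1}. cmod ((\<Sum>j\<in>{1..n}. w / (1 - x j * w)) / n - \<sigma>) \<le> 2 * (\<kappa> n * exp (\<kappa> n * r))"
      using average_near_constant[of "{1..n}" z "exp (- l * real n)" r] n z le r
      by (auto simp: \<kappa>_def)
    obtain w where "w \<in> {1/r..(1/r+1)/2}" "\<eta> < cmod ((\<Sum>j\<in>{1..n}. w / (1 - x j * w)) / n - \<sigma>)"
      using avg[of "{1..n}" x \<sigma>] x n by auto
    moreover from this have "w \<in> {1/r..1}" using r by auto
    ultimately show False using w N[OF n(1)] by fastforce
  qed
  then show ?thesis by blast
qed

section \<open>The extremal problem\<close>

lemma P_nonneg: "n \<ge> 1 \<Longrightarrow> 0 \<le> P n z"
  unfolding P_def
  by (rule order_trans[OF norm_ge_zero[of "\<Sum>j=1..n. z j ^ 2"] Max_ge]) auto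

lemma P_ones: "n \<ge> 1 \<Longrightarrow> P n (\<lambda>_. 1) = real n"
  by (simp add: P_def image_constant_conv)

lemma Delta_bounds:
  assumes n: "n \<ge> 1" and a: "\<And>z. \<forall>j\<in>{1..n}. 1 \<le> cmod (z j) \<Longrightarrow> a \<le> P n z"
  shows "a \<le> Delta n" "Delta n \<le> Delta_star n" "Delta_star n \<le> real n"
proof -
  let ?S = "{P n z | z. \<forall>j\<in>{1..n}. 1 \<le> cmod (z j)}"
  let ?T = "{P n z | z. z 1 = 1 \<and> (\<forall>j\<in>{1..n}. 1 \<le> cmod (z j))}"
  have ones: "real n \<in> ?T"
    using P_ones[OF n] by (auto intro!: exI[of _ "\<lambda>_. 1"])
  have sub: "?T \<subseteq> ?S" by blast
  have bdd: "bdd_below ?S" using P_nonneg[OF n] by (auto intro!: bdd_belowI[of _ 0])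
  show "a \<le> Delta n"
    unfolding Delta_def using ones sub a by (intro cInf_greatest) auto
  show "Delta n \<le> Delta_star n"
    unfolding Delta_def Delta_star_def using ones sub bdd by (intro cInf_superset_mono) auto
  show "Delta_star n \<le> real n"
    unfolding Delta_star_def using ones bdd_below_mono[OF bdd sub] by (rule cInf_lower)
qed

lemma root_tendsto_1:
  fixes f :: "nat \<Rightarrow> real"
  assumes lower: "\<And>l. l > 0 \<Longrightarrow> \<forall>\<^sub>F n in sequentially. exp (- l * real n) \<le> f n"
    and upper: "\<forall>\<^sub>F n in sequentially. f n \<le> real n"
  shows "(\<lambda>n. root n (f n)) \<longlonglongrightarrow> 1"
proof (rule order_tendstoI)
  fix a :: real assume "1 < a"
  then have "\<forall>\<^sub>F n in sequentially. root n n < a"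
    using order_tendstoD(2)[OF LIMSEQ_root] by blast
  then show "\<forall>\<^sub>F n in sequentially. root n (f n) < a"
    using upper eventually_gt_at_top[of 0]
  proof eventually_elim
    case (elim n)
    then have "root n (f n) \<le> root n n" by (simp add: real_root_le_mono)
    with elim(1) show ?case by linarith
  qed
next
  fix a :: real assume a: "a < 1"
  \<comment> \<open>The maximum makes \<open>ln b\<close> meaningful when \<open>a\<close> is not positive; halving \<open>- ln b\<close> makes
    \<open>a < exp (- l)\<close> strict.\<close>
  define b where "b = max a (1/2)"
  define l where "l = - ln b / 2"
  have b: "0 < b" "b < 1" "a \<le> b" using a by (auto simp: b_def)
  then have l: "l > 0" by (simp add: l_def)
  have "exp (ln b) < exp (- l)"
    using b ln_less_zero[of b] unfolding exp_less_cancel_iff l_def by linarith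
  then have ab: "a < exp (- l)" using b by simp
  show "\<forall>\<^sub>F n in sequentially. a < root n (f n)"
    using lower[OF l] eventually_gt_at_top[of 0]
  proof eventually_elim
    case (elim n)
    have "exp (- l * real n) = exp (- l) ^ n"
      by (simp add: mult.commute flip: exp_of_nat_mult)
    then have "root n (exp (- l * real n)) = exp (- l)"
      using elim by (simp add: real_root_power_cancel)
    moreover have "root n (exp (- l * real n)) \<le> root n (f n)"
      using elim by (simp add: real_root_le_mono)
    ultimately show ?case using ab by simp
  qed
qed

theorem theorem1p1:
  shows "(\<forall>l::real. l > 0 \<longrightarrow>
            (\<exists>N::nat. \<forall>n\<ge>N. n \<ge> 1 \<longrightarrow> (\<forall>z::nat \<Rightarrow> complex.
               (\<forall>j\<in>{1..n}. 1 \<le> cmod (z j)) \<longrightarrow> P n z > exp (- l * real n))))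
       \<and> (\<lambda>n. root n (Delta n)) \<longlonglongrightarrow> 1
       \<and> (\<lambda>n. root n (Delta_star n)) \<longlonglongrightarrow> 1
       \<and> \<not> (\<exists>C::real. C > 1 \<and>
            (\<forall>n::nat. n \<ge> 2 \<longrightarrow> (\<exists>z::nat \<Rightarrow> complex.
               z 1 = 1 \<and> (\<forall>j\<in>{1..n}. 1 \<le> cmod (z j)) \<and> P n z < C powr (- real n))))"
proof (intro conjI allI impI)
  have lower: "\<forall>\<^sub>F n in sequentially. exp (- l * real n) \<le> Delta n" if l: "l > 0" for l :: real
  proof -
    obtain N where N: "\<And>n z. n \<ge> N \<Longrightarrow> n \<ge> 1 \<Longrightarrow> \<forall>j\<in>{1..n}. 1 \<le> cmod (z j) \<Longrightarrow> exp (- l * real n) < P n z"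
      using power_sums_not_exponentially_small[OF l] by blast
    show ?thesis
      using eventually_ge_at_top[of "max N 1"]
    proof eventually_elim
      case (elim n)
      then show ?case using N[of n] by (intro Delta_bounds) (auto intro: less_imp_le)
    qed
  qed
  have upper: "\<forall>\<^sub>F n in sequentially. Delta n \<le> Delta_star n \<and> Delta_star n \<le> real n"
    using eventually_ge_at_top[of 1]
  proof eventually_elim
    case (elim n)
    then show ?case using Delta_bounds(2,3)[OF elim P_nonneg] by auto
  qed
  show "(\<lambda>n. root n (Delta n)) \<longlonglongrightarrow> 1"
    by (rule root_tendsto_1[OF lower]) (use upper in \<open>auto elim: eventually_mono\<close>)
  have "\<forall>\<^sub>F n in sequentially. exp (- l * real n) \<le> Delta_star n" if "l > 0" for l :: real
    using lower[OF that] upper by eventually_elim auto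
  then show "(\<lambda>n. root n (Delta_star n)) \<longlonglongrightarrow> 1"
    by (rule root_tendsto_1) (use upper in \<open>auto elim: eventually_mono\<close>)
  show "\<not> (\<exists>C::real. C > 1 \<and>
            (\<forall>n::nat. n \<ge> 2 \<longrightarrow> (\<exists>z::nat \<Rightarrow> complex.
               z 1 = 1 \<and> (\<forall>j\<in>{1..n}. 1 \<le> cmod (z j)) \<and> P n z < C powr (- real n))))"
  proof safe
    fix C :: real
    assume C: "C > 1" and ex: "\<forall>n::nat. n \<ge> 2 \<longrightarrow> (\<exists>z::nat \<Rightarrow> complex.
               z 1 = 1 \<and> (\<forall>j\<in>{1..n}. 1 \<le> cmod (z j)) \<and> P n z < C powr (- real n))"
    obtain N where N: "\<And>n z. n \<ge> N \<Longrightarrow> n \<ge> 1 \<Longrightarrow> \<forall>j\<in>{1..n}. 1 \<le> cmod (z j) \<Longrightarrow> exp (- ln C * real n) < P n z"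
      using power_sums_not_exponentially_small[of "ln C"] C by (auto simp del: exp_minus)
    define n where "n = max N 2"
    have "n \<ge> 2" by (simp add: n_def)
    then obtain z where z: "\<forall>j\<in>{1..n}. 1 \<le> cmod (z j)" "P n z < C powr (- real n)"
      using ex by blast
    have "C powr (- real n) = exp (- ln C * real n)"
      using C by (simp add: powr_def mult.commute)
    then show False using N[of n z] z by (simp add: n_def le_max_iff_disj)
  qed
qed (fact power_sums_not_exponentially_small)

end
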